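(* Let $X$ be a cancellative cone and let $Y$ be a subcone of $X$. Let $X/Y=\{[x] : x\in X\}$ be the set of equivalence classes $[x]=\{x+g : g\in G_Y\}$, where $G_Y=\{y\in Y : -y\in Y\}$. Then $X/Y$, endowed with the sum and product of equivalence classes $[x]+[z]:=[x+z]$ and $\lambda\cdot[x]:=[\lambda\cdot x]$ for $x,z\in X$ and $\lambda\in\mathbb{R}^+$, is a cancellative cone.
   Context: $\mathbb{R}^+$ is the set of nonnegative real numbers. A cone (on $\mathbb{R}^+$) is a triple $(X,+,\cdot)$ such that $(X,+)$ is an abelian monoid with neutral element $0$ and $\cdot:\mathbb{R}^+\times X\to X$ satisfies, for all $x,y\in X$ and $r,s\in\mathbb{R}^+$: $r\cdot(s\cdot x)=(rs)\cdot x$; $r\cdot(x+y)=r\cdot x+r\cdot y$; $(r+s)\cdot x=r\cdot x+s\cdot x$; $1\cdot x=x$; $0\cdot x=0$. It is cancellative if $z+x=z+y$ implies $x=y$ for all $x,y,z\in X$. A subcone of $X$ is a subset $Y$ of $X$ which is a cone under the restricted operations. For $y$ in a cone, $-y$ denotes the additive inverse of $y$ when it exists; "$-y\in Y$" means that $y$ has an additive inverse belonging to $Y$. The classes $[x]$ are the equivalence classes of the equivalence relation on $X$ in which $x$ and $z$ are related iff there exists $g\in G_Y$ with $x+g=z$. *)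

theory Defs
  imports Complex_Main "HOL-Algebra.Group"
begin

text \<open>
  The sum and the neutral element of a cone are written with the multiplicative symbols
  \<open>\<otimes>\<close> and \<open>\<one>\<close> of the monoid record; accordingly \<open>inv\<close> is the additive
  inverse. Scalars are real numbers, and only nonnegative ones carry meaning.
\<close>

record 'a scalar_monoid = "'a monoid" +
  scal :: "real \<Rightarrow> 'a \<Rightarrow> 'a" (infixr "\<cdot>\<index>" 75)

locale cone = comm_monoid X for X (structure) +
  assumes scal_closed: "0 \<le> r \<Longrightarrow> x \<in> carrier X \<Longrightarrow> r \<cdot> x \<in> carrier X"
    and scal_scal: "0 \<le> r \<Longrightarrow> 0 \<le> s \<Longrightarrow> x \<in> carrier X \<Longrightarrow> r \<cdot> (s \<cdot> x) = (r * s) \<cdot> x"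
    and scal_add_right: "0 \<le> r \<Longrightarrow> x \<in> carrier X \<Longrightarrow> y \<in> carrier X \<Longrightarrow>
      r \<cdot> (x \<otimes> y) = (r \<cdot> x) \<otimes> (r \<cdot> y)"
    and scal_add_left: "0 \<le> r \<Longrightarrow> 0 \<le> s \<Longrightarrow> x \<in> carrier X \<Longrightarrow>
      (r + s) \<cdot> x = (r \<cdot> x) \<otimes> (s \<cdot> x)"
    and scal_one: "x \<in> carrier X \<Longrightarrow> 1 \<cdot> x = x"
    and scal_zero: "x \<in> carrier X \<Longrightarrow> 0 \<cdot> x = \<one>"

locale cancellative_cone = cone +
  assumes cancel: "x \<in> carrier X \<Longrightarrow> y \<in> carrier X \<Longrightarrow> z \<in> carrier X \<Longrightarrow>
    z \<otimes> x = z \<otimes> y \<Longrightarrow> x = y"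

text \<open>
  Keeping the neutral element of \<open>X\<close> in the next definition is no restriction; see
  \<open>subcone_neutral\<close> below.
\<close>

definition subcone :: "'a set \<Rightarrow> ('a, 'm) scalar_monoid_scheme \<Rightarrow> bool" where
  "subcone Y X \<longleftrightarrow> Y \<subseteq> carrier X \<and> cone (X\<lparr>carrier := Y\<rparr>)"

lemma subcone_neutral:
  assumes "cone X" and "Y \<subseteq> carrier X" and "cone (X\<lparr>carrier := Y, one := e\<rparr>)"
  shows "e = \<one>\<^bsub>X\<^esub>"
proof -
  interpret X: cone X by fact
  interpret Y: cone "X\<lparr>carrier := Y, one := e\<rparr>" by fact
  have e: "e \<in> Y" using Y.one_closed by simp
  show ?thesis using Y.scal_zero[of e] X.scal_zero[of e] e assms(2) by auto
qed

definition invertibles :: "('a, 'm) scalar_monoid_scheme \<Rightarrow> 'a set \<Rightarrow> 'a set" where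
  "invertibles X Y = {y \<in> Y. y \<in> Units X \<and> inv\<^bsub>X\<^esub> y \<in> Y}"

definition cone_rel :: "('a, 'm) scalar_monoid_scheme \<Rightarrow> 'a set \<Rightarrow> ('a \<times> 'a) set" where
  "cone_rel X Y =
    {(x, z). x \<in> carrier X \<and> z \<in> carrier X \<and> (\<exists>g \<in> invertibles X Y. x \<otimes>\<^bsub>X\<^esub> g = z)}"

definition cone_class :: "('a, 'm) scalar_monoid_scheme \<Rightarrow> 'a set \<Rightarrow> 'a \<Rightarrow> 'a set" where
  "cone_class X Y x = {x \<otimes>\<^bsub>X\<^esub> g | g. g \<in> invertibles X Y}"

text \<open>
  The operations are defined on classes by taking the union over all representatives, so that
  \<open>[x] + [z] = [x + z]\<close> and \<open>r [x] = [r x]\<close> hold exactly when the choice of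
  representatives does not matter.
\<close>

definition quotient_cone ::
    "('a, 'm) scalar_monoid_scheme \<Rightarrow> 'a set \<Rightarrow> 'a set scalar_monoid" where
  "quotient_cone X Y =
    \<lparr>carrier = cone_class X Y ` carrier X,
     mult = (\<lambda>A B. \<Union>x\<in>A. \<Union>z\<in>B. cone_class X Y (x \<otimes>\<^bsub>X\<^esub> z)),
     one = cone_class X Y \<one>\<^bsub>X\<^esub>,
     scal = (\<lambda>r A. \<Union>x\<in>A. cone_class X Y (r \<cdot>\<^bsub>X\<^esub> x))\<rparr>"

end

theory Submission
  imports Defs
begin

text \<open>
  \<open>G\<^sub>Y\<close> is a subgroup of the units of \<open>X\<close> that is stable under nonnegative scalars, the inverse
  of \<open>r \<cdot> g\<close> being \<open>r \<cdot> (- g)\<close>. Hence adding elements of \<open>G\<^sub>Y\<close> to the arguments changes a sum or a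
  scalar multiple only by an element of \<open>G\<^sub>Y\<close>, and the cone axioms pass to classes. Cancellation
  in \<open>X\<close> is used only for cancellation in the quotient: \<open>z + x + g = z + y\<close> gives \<open>x + g = y\<close>.
\<close>

locale cone_with_subcone = cone X for X :: "('a, 'm) scalar_monoid_scheme" (structure) +
  fixes Y :: "'a set"
  assumes subcone: "subcone Y X"
begin

abbreviation "G \<equiv> invertibles X Y"
abbreviation "cls \<equiv> cone_class X Y"
abbreviation "Q \<equiv> quotient_cone X Y"

lemma cone_subcone: "cone (X\<lparr>carrier := Y\<rparr>)"
  using subcone by (simp add: subcone_def)

lemma subcone_mult_closed: "x \<in> Y \<Longrightarrow> y \<in> Y \<Longrightarrow> x \<otimes> y \<in> Y"
  using monoid.m_closed[OF comm_monoid.axioms(1)[OF cone.axioms(1)[OF cone_subcone]]] by simp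

lemma subcone_one_closed: "\<one> \<in> Y"
  using monoid.one_closed[OF comm_monoid.axioms(1)[OF cone.axioms(1)[OF cone_subcone]]] by simp

lemma subcone_scal_closed: "0 \<le> r \<Longrightarrow> x \<in> Y \<Longrightarrow> r \<cdot> x \<in> Y"
  using cone.scal_closed[OF cone_subcone] by simp

text \<open>Since \<open>\<one>\<close> equals \<open>0 \<cdot> \<one>\<close>, a scalar
  \<open>r\<close> is absorbed through \<open>r * 0 = 0\<close>.\<close>

lemma scal_neutral: "0 \<le> r \<Longrightarrow> r \<cdot> \<one> = \<one>"
  using scal_scal[of r 0 \<one>] by (simp add: scal_zero)

lemma invertiblesD:
  assumes "g \<in> G"
  shows "g \<in> carrier X" and "g \<in> Y" and "g \<in> Units X" and "inv g \<in> Y"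
  using assms by (auto simp: invertibles_def)

text \<open>By commutativity a one-sided inverse is two-sided, hence equal to \<open>inv g\<close>.
  Membership in \<open>G\<close> then only requires exhibiting some \<open>h\<close> in
  \<open>Y\<close>, with no computation of \<open>inv\<close> for products or scalar
  multiples.\<close>

lemma invertiblesI:
  assumes "g \<in> Y" "h \<in> Y" "g \<otimes> h = \<one>"
  shows "g \<in> G"
proof -
  have carrier: "g \<in> carrier X" "h \<in> carrier X"
    using assms subcone by (auto simp: subcone_def)
  then have "h \<otimes> g = \<one>" using assms(3) m_comm by simp
  with carrier assms(3) have "g \<in> Units X" "inv g = h"
    using inv_unique'[of g h] by (auto simp: Units_def)
  with assms show ?thesis by (simp add: invertibles_def)
qed

lemma invertibles_one: "\<one> \<in> G"
  using invertiblesI[of \<one> \<one>] subcone_one_closed by simp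

lemma invertibles_mult: "g \<in> G \<Longrightarrow> h \<in> G \<Longrightarrow> g \<otimes> h \<in> G"
proof (rule invertiblesI[where h = "inv g \<otimes> inv h"])
  assume g: "g \<in> G" and h: "h \<in> G"
  note gD = invertiblesD[OF g] and hD = invertiblesD[OF h]
  show "g \<otimes> h \<in> Y" "inv g \<otimes> inv h \<in> Y"
    using gD hD by (simp_all add: subcone_mult_closed)
  have "(g \<otimes> h) \<otimes> (inv g \<otimes> inv h) = (g \<otimes> inv g) \<otimes> (h \<otimes> inv h)"
    using gD hD by (simp add: m_ac)
  then show "(g \<otimes> h) \<otimes> (inv g \<otimes> inv h) = \<one>"
    using gD hD by simp
qed

lemma invertibles_inv: "g \<in> G \<Longrightarrow> inv g \<in> G"
  by (rule invertiblesI[of _ g]) (auto dest: invertiblesD)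

lemma invertibles_scal: "0 \<le> r \<Longrightarrow> g \<in> G \<Longrightarrow> r \<cdot> g \<in> G"
proof (rule invertiblesI[where h = "r \<cdot> inv g"])
  assume r: "0 \<le> r" and g: "g \<in> G"
  note gD = invertiblesD[OF g]
  show "r \<cdot> g \<in> Y" "r \<cdot> inv g \<in> Y"
    using r gD by (simp_all add: subcone_scal_closed)
  have "r \<cdot> g \<otimes> r \<cdot> inv g = r \<cdot> (g \<otimes> inv g)"
    using r gD by (simp flip: scal_add_right)
  then show "r \<cdot> g \<otimes> r \<cdot> inv g = \<one>"
    using r gD by (simp add: scal_neutral)
qed

lemma cone_rel_iff:
  "(x, z) \<in> cone_rel X Y \<longleftrightarrow> x \<in> carrier X \<and> z \<in> carrier X \<and> (\<exists>g \<in> G. x \<otimes> g = z)"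
  by (simp add: cone_rel_def)

text \<open>Reflexivity, symmetry and transitivity reflect that \<open>G\<close> contains
  \<open>\<one>\<close> and is closed under inverses and sums.\<close>

lemma equiv_cone_rel: "equiv (carrier X) (cone_rel X Y)"
proof (rule equivI)
  show "cone_rel X Y \<subseteq> carrier X \<times> carrier X"
    by (auto simp: cone_rel_iff)
  show "refl_on (carrier X) (cone_rel X Y)"
    using invertibles_one by (auto simp: refl_on_def cone_rel_iff intro!: bexI[of _ \<one>])
  show "sym (cone_rel X Y)"
  proof (rule symI)
    fix x z assume "(x, z) \<in> cone_rel X Y"
    then obtain g where x: "x \<in> carrier X" "z \<in> carrier X" and g: "g \<in> G" "x \<otimes> g = z"
      by (auto simp: cone_rel_iff)
    have "z \<otimes> inv g = x"
      using g(2) x invertiblesD[OF g(1)] by (auto simp: m_assoc)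
    with x g show "(z, x) \<in> cone_rel X Y"
      using invertibles_inv by (auto simp: cone_rel_iff)
  qed
  show "trans (cone_rel X Y)"
  proof (rule transI)
    fix x y z assume "(x, y) \<in> cone_rel X Y" "(y, z) \<in> cone_rel X Y"
    then obtain g h where x: "x \<in> carrier X" "z \<in> carrier X" and g: "g \<in> G" "h \<in> G"
      and z: "z = x \<otimes> g \<otimes> h"
      by (auto simp: cone_rel_iff)
    have "x \<otimes> (g \<otimes> h) = z"
      using x z g by (simp add: invertiblesD m_assoc)
    with x g show "(x, z) \<in> cone_rel X Y"
      using invertibles_mult by (auto simp: cone_rel_iff)
  qed
qed

lemma cone_rel_Image: "x \<in> carrier X \<Longrightarrow> cone_rel X Y `` {x} = cls x"
  by (auto simp: cone_rel_iff cone_class_def invertiblesD(1))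

text \<open>Classes of an equivalence relation coincide exactly when their representatives are
  related. An equality of sets thus becomes the existence of one \<open>g\<close>, the form in which
  cancellation can act.\<close>

lemma cone_class_eq_iff:
  "x \<in> carrier X \<Longrightarrow> z \<in> carrier X \<Longrightarrow> cls x = cls z \<longleftrightarrow> (\<exists>g \<in> G. x \<otimes> g = z)"
  using eq_equiv_class_iff[OF equiv_cone_rel] by (simp add: cone_rel_Image cone_rel_iff)

lemma cone_class_add_invertible: "x \<in> carrier X \<Longrightarrow> g \<in> G \<Longrightarrow> cls (x \<otimes> g) = cls x"
  using cone_class_eq_iff[of x "x \<otimes> g"] by (auto simp: invertiblesD(1))

text \<open>The operations of \<open>Q\<close> are unions over classes; a constant union collapses
  to its value only over a nonempty index set.\<close>

lemma cone_class_nonempty: "cls x \<noteq> {}"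
  using invertibles_one by (auto simp: cone_class_def)

lemma quotient_mult:
  assumes x: "x \<in> carrier X" and z: "z \<in> carrier X"
  shows "cls x \<otimes>\<^bsub>Q\<^esub> cls z = cls (x \<otimes> z)"
proof -
  have "cls (x' \<otimes> z') = cls (x \<otimes> z)" if "x' \<in> cls x" "z' \<in> cls z" for x' z'
  proof -
    obtain g h where g: "g \<in> G" "h \<in> G" and eq: "x' = x \<otimes> g" "z' = z \<otimes> h"
      using \<open>x' \<in> cls x\<close> \<open>z' \<in> cls z\<close> by (auto simp: cone_class_def)
    \<comment> \<open>Collecting the two perturbations on the right gives a single element of
      \<open>G\<close>, which the class absorbs.\<close>
    have "x' \<otimes> z' = (x \<otimes> z) \<otimes> (g \<otimes> h)"
      using x z g eq by (simp add: invertiblesD(1) m_ac)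
    then show ?thesis
      using x z g by (simp add: cone_class_add_invertible invertibles_mult)
  qed
  then have "(\<Union>x'\<in>cls x. \<Union>z'\<in>cls z. cls (x' \<otimes> z')) = (\<Union>x'\<in>cls x. \<Union>z'\<in>cls z. cls (x \<otimes> z))"
    by (intro SUP_cong refl) simp
  then show ?thesis
    by (simp add: quotient_cone_def cone_class_nonempty)
qed

text \<open>Distributivity turns the perturbation \<open>g\<close> of \<open>x\<close> into the
  perturbation \<open>r \<cdot> g\<close> of \<open>r \<cdot> x\<close>, again in
  \<open>G\<close>.\<close>

lemma quotient_scal:
  assumes r: "0 \<le> r" and x: "x \<in> carrier X"
  shows "r \<cdot>\<^bsub>Q\<^esub> cls x = cls (r \<cdot> x)"
proof -
  have "cls (r \<cdot> x') = cls (r \<cdot> x)" if "x' \<in> cls x" for x'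
  proof -
    obtain g where g: "g \<in> G" and eq: "x' = x \<otimes> g"
      using \<open>x' \<in> cls x\<close> by (auto simp: cone_class_def)
    have "r \<cdot> x' = r \<cdot> x \<otimes> r \<cdot> g"
      using r x g eq by (simp add: invertiblesD(1) scal_add_right)
    then show ?thesis
      using r x g by (simp add: cone_class_add_invertible invertibles_scal scal_closed)
  qed
  then have "(\<Union>x'\<in>cls x. cls (r \<cdot> x')) = (\<Union>x'\<in>cls x. cls (r \<cdot> x))"
    by (intro SUP_cong refl) simp
  then show ?thesis
    by (simp add: quotient_cone_def cone_class_nonempty)
qed

lemma quotient_carrier: "carrier Q = cls ` carrier X"
  by (simp add: quotient_cone_def)

lemma quotient_one: "\<one>\<^bsub>Q\<^esub> = cls \<one>"
  by (simp add: quotient_cone_def)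

text \<open>Every element of \<open>Q\<close> has a representative and the operations are computed
  on representatives, so each axiom is the image under \<open>cls\<close> of the same axiom in
  \<open>X\<close>. Commutativity is treated apart, which keeps the permutative rule
  \<open>m_comm\<close> out of the other simplifications.\<close>

lemma cone_quotient: "cone Q"
proof (intro cone.intro comm_monoidI cone_axioms.intro)
  fix A B assume "A \<in> carrier Q" "B \<in> carrier Q"
  then show "A \<otimes>\<^bsub>Q\<^esub> B = B \<otimes>\<^bsub>Q\<^esub> A"
    by (auto simp: quotient_carrier quotient_mult m_comm)
qed (auto simp: quotient_carrier quotient_one quotient_mult quotient_scal scal_closed
    scal_scal scal_add_right scal_add_left scal_one scal_zero m_assoc)

lemma quotient_cancel:
  assumes X: "cancellative_cone X" and x: "x \<in> carrier X" and y: "y \<in> carrier X"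
    and z: "z \<in> carrier X" and eq: "cls z \<otimes>\<^bsub>Q\<^esub> cls x = cls z \<otimes>\<^bsub>Q\<^esub> cls y"
  shows "cls x = cls y"
proof -
  have "cls (z \<otimes> x) = cls (z \<otimes> y)"
    using eq x y z by (simp add: quotient_mult)
  then obtain g where g: "g \<in> G" and "z \<otimes> x \<otimes> g = z \<otimes> y"
    using x y z by (auto simp: cone_class_eq_iff)
  \<comment> \<open>Reassociating puts \<open>g\<close> next to \<open>x\<close>, so that
    \<open>z\<close> stands alone on the left and can be cancelled.\<close>
  then have "z \<otimes> (x \<otimes> g) = z \<otimes> y"
    using x z by (simp add: invertiblesD(1) m_assoc)
  then have "x \<otimes> g = y"
    using cancellative_cone.cancel[OF X, of "x \<otimes> g" y z] x y z g by (simp add: invertiblesD(1))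
  with x y g show ?thesis
    by (auto simp: cone_class_eq_iff)
qed

lemma cancellative_cone_quotient:
  assumes "cancellative_cone X"
  shows "cancellative_cone Q"
  using cone_quotient quotient_cancel[OF assms]
  by (intro cancellative_cone.intro cancellative_cone_axioms.intro) (auto simp: quotient_carrier)

end

text \<open>The conjuncts before the last tie the encoding to the informal quotient: the cosets of
  \<open>G\<close> are genuine equivalence classes, and the operations defined by unions are the
  prescribed ones.\<close>

theorem proposition2:
  fixes X :: "('a, 'm) scalar_monoid_scheme" and Y :: "'a set"
  assumes "cancellative_cone X" and "subcone Y X"
  shows "equiv (carrier X) (cone_rel X Y)
    \<and> (\<forall>x \<in> carrier X. cone_rel X Y `` {x} = cone_class X Y x)
    \<and> (\<forall>x \<in> carrier X. \<forall>z \<in> carrier X.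
      cone_class X Y x \<otimes>\<^bsub>quotient_cone X Y\<^esub> cone_class X Y z = cone_class X Y (x \<otimes>\<^bsub>X\<^esub> z))
    \<and> (\<forall>r \<ge> 0. \<forall>x \<in> carrier X.
      r \<cdot>\<^bsub>quotient_cone X Y\<^esub> cone_class X Y x = cone_class X Y (r \<cdot>\<^bsub>X\<^esub> x))
    \<and> cancellative_cone (quotient_cone X Y)"
proof -
  interpret cone_with_subcone X Y
    using assms by (intro cone_with_subcone.intro cone_with_subcone_axioms.intro
        cancellative_cone.axioms(1))
  show ?thesis
    using equiv_cone_rel cone_rel_Image quotient_mult quotient_scal
      cancellative_cone_quotient[OF assms(1)] by blast
qed

end
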